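(* Let $m=1$ (so the unknown parameter $\theta$ and the regressors $\phi_{k,i}$ are scalars). Assume: (1) $\mathcal{A}$ is an irreducible and aperiodic doubly stochastic matrix and $\mathcal{A}^{\tau}\mathcal{A}$ is irreducible; (2) the noise vectors $(\varepsilon_{k,1},\ldots,\varepsilon_{k,n})^{\tau}$, $k\ge 0$, are mutually independent, and for each $i=1,\ldots,n$, $E\varepsilon_{k,i}=0$ for all $k\geq 0$ and $\sup_{k\geq 0}E\varepsilon_{k,i}^2<M$, where $M>0$ is a constant; (3) all $\phi_{k,i}$, $i=1,\ldots,n$, $k\geq 0$, are non-random constants. Then the diffusion recursive least squares algorithm satisfies $$\|\widetilde\Theta_{k}\|\to 0 \ \text{ almost surely}\quad\text{and}\quad E\|\widetilde\Theta_{k}\|^2\rightarrow 0\qquad\text{as } k\rightarrow+\infty$$ for every initial value $\Theta_0\in\mathbb{R}^n$, if and only if $$\lim_{k\rightarrow+\infty}\sum_{i=1}^nP_{k+1,i}^{-1}=+\infty.$$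
   Context: Model: there are $n$ nodes and an unknown deterministic parameter $\theta\in\mathbb{R}^m$. At time $k\ge 0$ node $i\in\{1,\dots,n\}$ observes $\phi_{k,i}\in\mathbb{R}^m$ and $y_{k,i}=\theta^{\tau}\phi_{k,i}+\varepsilon_{k,i}\in\mathbb{R}$, where $\varepsilon_{k,i}$ is scalar noise and $(\cdot)^\tau$ denotes transpose. $\mathcal{A}=(a_{ij})_{n\times n}$ is the nonnegative weighted adjacency matrix of a directed graph on $\{1,\dots,n\}$ with edge set $\mathcal E$: $a_{ij}>0$ if $(i,j)\in\mathcal E$ and $a_{ij}=0$ otherwise. Diffusion recursive least squares (RLS), adapt-then-combine form: with initial estimates $\theta_{0,i}\in\mathbb{R}^m$ and $P_{0,i}=I_m$, for $k\ge 0$, $$P_{k+1,i}^{-1}=I_m+\sum_{j=0}^{k}\phi_{j,i}\phi_{j,i}^{\tau},\qquad L_{k,i}=P_{k+1,i}\phi_{k,i}=\frac{P_{k,i}\phi_{k,i}}{1+\phi_{k,i}^{\tau}P_{k,i}\phi_{k,i}},$$ $$\beta_{k+1,i}=\theta_{k,i}+L_{k,i}(y_{k,i}-\theta_{k,i}^{\tau}\phi_{k,i}),\qquad \theta_{k+1,i}=\sum_{j=1}^{n}a_{ij}\beta_{k+1,j}.$$ Notation: $\Theta_k=\mathrm{col}\{\theta_{k,1},\dots,\theta_{k,n}\}$, $\widetilde\Theta_k=\mathrm{col}\{\theta_{k,1}-\theta,\dots,\theta_{k,n}-\theta\}\in\mathbb{R}^{mn}$; $\|\cdot\|$ is the Euclidean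 (spectral) norm. An irreducible nonnegative matrix is aperiodic if the greatest common divisor of the lengths of closed walks in its directed graph is $1$. *)

theory Defs
  imports "HOL-Probability.Probability"
begin

definition doubly_stochastic :: "real ^ 'n ^ 'n \<Rightarrow> bool" where
  "doubly_stochastic A \<longleftrightarrow>
     (\<forall>i j. 0 \<le> A $ i $ j) \<and>
     (\<forall>i. (\<Sum>j\<in>UNIV. A $ i $ j) = 1) \<and>
     (\<forall>j. (\<Sum>i\<in>UNIV. A $ i $ j) = 1)"

definition mat_edges :: "real ^ 'n ^ 'n \<Rightarrow> 'n rel" where
  "mat_edges A = {(i, j). A $ i $ j > 0}"

text \<open>
  A nonnegative matrix is irreducible when its directed graph is strongly connected: any two
  nodes (not necessarily distinct) are joined by a walk of positive length.
\<close>

definition irreducible_mat :: "real ^ 'n ^ 'n \<Rightarrow> bool" where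
  "irreducible_mat A \<longleftrightarrow>
     (\<forall>i j. 0 \<le> A $ i $ j) \<and> (\<forall>i j. (i, j) \<in> (mat_edges A)\<^sup>+)"

text \<open>
  The relational power \<open>mat_edges A ^^ l\<close> relates the endpoints of the walks of length \<open>l\<close>.
\<close>

definition aperiodic_mat :: "real ^ 'n ^ 'n \<Rightarrow> bool" where
  "aperiodic_mat A \<longleftrightarrow> Gcd {l. l > 0 \<and> (\<exists>i. (i, i) \<in> mat_edges A ^^ l)} = 1"

text \<open>
  Scalar diffusion recursive least squares on the node set \<open>'n\<close>: \<open>\<phi> k $ i\<close> is the
  regressor and \<open>y k $ i\<close> the observation of node \<open>i\<close> at time \<open>k\<close>.  The gain
  \<open>rls_P \<phi> k i\<close> is given by its inverse, \<open>1 + (\<Sum>j<k. (\<phi> j $ i)\<^sup>2)\<close>, which is positive;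
  at \<open>k = 0\<close> the gain is \<open>1\<close>.
\<close>

definition rls_P :: "(nat \<Rightarrow> real ^ 'n) \<Rightarrow> nat \<Rightarrow> 'n \<Rightarrow> real" where
  "rls_P \<phi> k i = inverse (1 + (\<Sum>j<k. \<phi> j $ i * \<phi> j $ i))"

definition rls_L :: "(nat \<Rightarrow> real ^ 'n) \<Rightarrow> nat \<Rightarrow> 'n \<Rightarrow> real" where
  "rls_L \<phi> k i = rls_P \<phi> (Suc k) i * \<phi> k $ i"

lemma rls_L_eq:
  "rls_L \<phi> k i = rls_P \<phi> k i * \<phi> k $ i / (1 + \<phi> k $ i * rls_P \<phi> k i * \<phi> k $ i)"
proof -
  define s where "s = 1 + (\<Sum>j<k. \<phi> j $ i * \<phi> j $ i)"
  have s: "s > 0"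
    unfolding s_def by (intro add_pos_nonneg sum_nonneg) auto
  have "s + \<phi> k $ i * \<phi> k $ i > 0"
    using s by (intro add_pos_nonneg) auto
  moreover have "rls_P \<phi> k i = inverse s" "rls_P \<phi> (Suc k) i = inverse (s + \<phi> k $ i * \<phi> k $ i)"
    by (simp_all add: rls_P_def s_def add.assoc)
  moreover have "1 + \<phi> k $ i * inverse s * \<phi> k $ i = (s + \<phi> k $ i * \<phi> k $ i) / s"
    using s by (simp add: field_simps)
  ultimately show ?thesis
    using s by (simp add: rls_L_def inverse_eq_divide)
qed

text \<open>
  Adaptation \<open>rls_adapt\<close> maps the estimates at time \<open>k\<close> to the intermediate estimates
  \<open>\<beta>\<close> at time \<open>k + 1\<close>; the combination step multiplies by the weight matrix \<open>A\<close>.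
\<close>

definition rls_adapt ::
  "(nat \<Rightarrow> real ^ 'n) \<Rightarrow> (nat \<Rightarrow> real ^ 'n) \<Rightarrow> nat \<Rightarrow> real ^ 'n \<Rightarrow> real ^ 'n" where
  "rls_adapt \<phi> y k \<Theta> = (\<chi> i. \<Theta> $ i + rls_L \<phi> k i * (y k $ i - \<Theta> $ i * \<phi> k $ i))"

primrec diffusion_rls ::
  "real ^ 'n ^ 'n \<Rightarrow> (nat \<Rightarrow> real ^ 'n) \<Rightarrow> (nat \<Rightarrow> real ^ 'n) \<Rightarrow> real ^ 'n \<Rightarrow> nat \<Rightarrow> real ^ 'n"
where
  "diffusion_rls A \<phi> y \<Theta>\<^sub>0 0 = \<Theta>\<^sub>0"
| "diffusion_rls A \<phi> y \<Theta>\<^sub>0 (Suc k) = A *v rls_adapt \<phi> y k (diffusion_rls A \<phi> y \<Theta>\<^sub>0 k)"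

definition observation ::
  "real \<Rightarrow> (nat \<Rightarrow> real ^ 'n) \<Rightarrow> (nat \<Rightarrow> 'a \<Rightarrow> real ^ 'n) \<Rightarrow> 'a \<Rightarrow> nat \<Rightarrow> real ^ 'n" where
  "observation \<theta> \<phi> \<epsilon> \<omega> k = (\<chi> i. \<theta> * \<phi> k $ i + \<epsilon> k \<omega> $ i)"

definition rls_error ::
  "real ^ 'n ^ 'n \<Rightarrow> real \<Rightarrow> (nat \<Rightarrow> real ^ 'n) \<Rightarrow> (nat \<Rightarrow> 'a \<Rightarrow> real ^ 'n) \<Rightarrow> real ^ 'n
    \<Rightarrow> nat \<Rightarrow> 'a \<Rightarrow> real ^ 'n" where
  "rls_error A \<theta> \<phi> \<epsilon> \<Theta>\<^sub>0 k \<omega> =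
     diffusion_rls A \<phi> (observation \<theta> \<phi> \<epsilon> \<omega>) \<Theta>\<^sub>0 k - (\<chi> i. \<theta>)"

end

theory Submission
  imports Defs
begin

text \<open>
  The error satisfies \<open>x\<^sub>k\<^sub>+\<^sub>1 = A (D\<^sub>k x\<^sub>k + L\<^sub>k \<epsilon>\<^sub>k)\<close>, where \<open>D\<^sub>k\<close> is diagonal with entries
  \<open>r\<^sub>k\<^sub>,\<^sub>i / r\<^sub>k\<^sub>+\<^sub>1\<^sub>,\<^sub>i\<close> and \<open>r\<^sub>k\<^sub>,\<^sub>i\<close> is the inverse gain.  Without noise the norm decreases, and the
  loss in the combination step is the Dirichlet form of \<open>A\<^sup>\<tau> A\<close>; as this matrix is irreducible,
  the components approach each other.  If the limit of the norm were positive, all components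
  would stay away from 0, so the losses in the adaptation step would make
  \<open>\<Sum>\<^sub>k (1 - r\<^sub>k\<^sub>,\<^sub>i / r\<^sub>k\<^sub>+\<^sub>1\<^sub>,\<^sub>i)\<close> converge and hence \<open>r\<^sub>k\<^sub>,\<^sub>i\<close> bounded for every \<open>i\<close>.

  The noise is square summable, since \<open>L\<^sub>k\<^sub>,\<^sub>i\<^sup>2 \<le> 1 / r\<^sub>k\<^sub>,\<^sub>i - 1 / r\<^sub>k\<^sub>+\<^sub>1\<^sub>,\<^sub>i\<close>.  The noise before a time \<open>N\<close>
  is forgotten by stability, and the effect of the noise after \<open>N\<close> is small uniformly in time, in
  mean square by orthogonality and in probability by a maximal inequality.

  Conversely, the difference of the errors for the initial errors \<open>(1, \<dots>, 1)\<close> and 0 is free of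
  noise, and each of its components at time \<open>k\<close> is at least \<open>1 / (\<Prod>\<^sub>i r\<^sub>k\<^sub>,\<^sub>i)\<close>.
\<close>

section \<open>Stability of the noise-free recursion\<close>

text \<open>The variance under the weights \<open>p\<close> is half the mean squared difference of
  two independent copies: expanding that square gives twice the second moment minus twice the
  squared mean.\<close>

lemma variance_eq_pairwise:
  fixes p y :: "'n::finite \<Rightarrow> real"
  assumes "(\<Sum>i\<in>UNIV. p i) = 1"
  shows "(\<Sum>i\<in>UNIV. p i * (y i)\<^sup>2) - (\<Sum>i\<in>UNIV. p i * y i)\<^sup>2
       = (\<Sum>i\<in>UNIV. \<Sum>j\<in>UNIV. p i * p j * (y i - y j)\<^sup>2) / 2"
proof -
  let ?m = "\<Sum>i\<in>UNIV. p i * y i" and ?s = "\<Sum>i\<in>UNIV. p i * (y i)\<^sup>2"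
  have "(\<Sum>j\<in>UNIV. p i * p j * (y i - y j)\<^sup>2) = p i * (y i)\<^sup>2 + p i * ?s - 2 * (p i * y i) * ?m" for i
  proof -
    have "(\<Sum>j\<in>UNIV. p i * p j * (y i - y j)\<^sup>2)
        = (\<Sum>j\<in>UNIV. p i * (y i)\<^sup>2 * p j + p i * (p j * (y j)\<^sup>2) - 2 * (p i * y i) * (p j * y j))"
      by (intro sum.cong) (auto simp: power2_eq_square algebra_simps)
    then show ?thesis
      using assms by (simp add: sum.distrib sum_subtractf flip: sum_distrib_left)
  qed
  then have "(\<Sum>i\<in>UNIV. \<Sum>j\<in>UNIV. p i * p j * (y i - y j)\<^sup>2)
      = (\<Sum>i\<in>UNIV. p i * (y i)\<^sup>2 + p i * ?s - 2 * (p i * y i) * ?m)"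
    by simp
  also have "\<dots> = ?s + ?s - 2 * ?m * ?m"
    using assms
    by (simp add: sum.distrib sum_subtractf flip: sum_distrib_left sum_distrib_right)
  finally show ?thesis
    by (simp add: power2_eq_square)
qed

lemma norm_vec_power2:
  fixes x :: "real ^ 'n"
  shows "(norm x)\<^sup>2 = (\<Sum>i\<in>UNIV. (x $ i)\<^sup>2)"
  by (simp add: norm_vec_def L2_set_def sum_nonneg)

lemma tendsto_zero_if_power2:
  fixes f :: "'b \<Rightarrow> real"
  assumes "((\<lambda>x. (f x)\<^sup>2) \<longlongrightarrow> 0) F"
  shows "(f \<longlongrightarrow> 0) F"
  using tendsto_real_sqrt[OF assms] by (simp add: tendsto_rabs_zero_iff)

text \<open>Column sums 1 distribute the squared norm of \<open>y\<close> over the rows, so the loss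
  is the sum over rows \<open>k\<close> of the variance of \<open>y\<close> under the weights
  \<open>A $ k $ i\<close>. In pairwise form, summing over \<open>k\<close> collects
  \<open>A $ k $ i * A $ k $ j\<close> into the entries of \<open>transpose A ** A\<close>.\<close>

lemma doubly_stochastic_norm_loss:
  fixes A :: "real ^ 'n ^ 'n"
  assumes "doubly_stochastic A"
  shows "(norm y)\<^sup>2 - (norm (A *v y))\<^sup>2
       = (\<Sum>i\<in>UNIV. \<Sum>j\<in>UNIV. (transpose A ** A) $ i $ j * (y $ i - y $ j)\<^sup>2) / 2"
proof -
  have row: "(\<Sum>j\<in>UNIV. A $ i $ j) = 1" and col: "(\<Sum>i\<in>UNIV. A $ i $ j) = 1" for i j
    using assms by (auto simp: doubly_stochastic_def)
  have "(norm y)\<^sup>2 = (\<Sum>i\<in>UNIV. \<Sum>k\<in>UNIV. A $ k $ i * (y $ i)\<^sup>2)"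
    by (simp add: norm_vec_power2 col flip: sum_distrib_right)
  also have "\<dots> = (\<Sum>k\<in>UNIV. \<Sum>i\<in>UNIV. A $ k $ i * (y $ i)\<^sup>2)"
    by (rule sum.swap)
  finally have "(norm y)\<^sup>2 - (norm (A *v y))\<^sup>2
      = (\<Sum>k\<in>UNIV. (\<Sum>i\<in>UNIV. A $ k $ i * (y $ i)\<^sup>2) - (\<Sum>i\<in>UNIV. A $ k $ i * y $ i)\<^sup>2)"
    by (simp add: norm_vec_power2 matrix_vector_mult_def sum_subtractf)
  also have "\<dots> = (\<Sum>k\<in>UNIV. \<Sum>i\<in>UNIV. \<Sum>j\<in>UNIV. A $ k $ i * A $ k $ j * (y $ i - y $ j)\<^sup>2) / 2"
    by (simp add: variance_eq_pairwise row sum_divide_distrib)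
  also have "(\<Sum>k\<in>UNIV. \<Sum>i\<in>UNIV. \<Sum>j\<in>UNIV. A $ k $ i * A $ k $ j * (y $ i - y $ j)\<^sup>2)
      = (\<Sum>i\<in>UNIV. \<Sum>k\<in>UNIV. \<Sum>j\<in>UNIV. A $ k $ i * A $ k $ j * (y $ i - y $ j)\<^sup>2)"
    by (rule sum.swap)
  also have "\<dots> = (\<Sum>i\<in>UNIV. \<Sum>j\<in>UNIV. \<Sum>k\<in>UNIV. A $ k $ i * A $ k $ j * (y $ i - y $ j)\<^sup>2)"
    by (intro sum.cong refl sum.swap)
  also have "\<dots> = (\<Sum>i\<in>UNIV. \<Sum>j\<in>UNIV. (transpose A ** A) $ i $ j * (y $ i - y $ j)\<^sup>2)"
    by (simp add: matrix_matrix_mult_def transpose_def sum_distrib_right)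
  finally show ?thesis .
qed

lemma gram_nonneg:
  fixes A :: "real ^ 'n ^ 'n"
  assumes "doubly_stochastic A"
  shows "(transpose A ** A) $ i $ j \<ge> 0"
  using assms
  by (auto simp: doubly_stochastic_def matrix_matrix_mult_def transpose_def intro!: sum_nonneg)

lemma doubly_stochastic_norm_le:
  fixes A :: "real ^ 'n ^ 'n"
  assumes "doubly_stochastic A"
  shows "norm (A *v y) \<le> norm y"
proof -
  have "(norm y)\<^sup>2 - (norm (A *v y))\<^sup>2 \<ge> 0"
    unfolding doubly_stochastic_norm_loss[OF assms]
    by (intro divide_nonneg_nonneg sum_nonneg mult_nonneg_nonneg gram_nonneg assms) auto
  then show ?thesis
    by (simp add: power2_le_iff_abs_le)
qed

text \<open>All terms of the Dirichlet form are nonnegative, so a vanishing loss forces the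
  difference across each edge of \<open>transpose A ** A\<close> to vanish. Differences add up along
  a walk, and irreducibility joins any two nodes by one.\<close>

lemma doubly_stochastic_consensus:
  fixes A :: "real ^ 'n ^ 'n" and y :: "nat \<Rightarrow> real ^ 'n"
  assumes A: "doubly_stochastic A" and irr: "irreducible_mat (transpose A ** A)"
    and lim: "(\<lambda>k. (norm (y k))\<^sup>2 - (norm (A *v y k))\<^sup>2) \<longlonglongrightarrow> 0"
  shows "(\<lambda>k. y k $ i - y k $ j) \<longlonglongrightarrow> 0"
proof -
  let ?Q = "transpose A ** A"
  have edge: "(\<lambda>k. y k $ i - y k $ j) \<longlonglongrightarrow> 0" if "(i, j) \<in> mat_edges ?Q" for i j
  proof -
    have Q: "?Q $ i $ j > 0"
      using that by (simp add: mat_edges_def)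
    have "(y k $ i - y k $ j)\<^sup>2 \<le> 2 / ?Q $ i $ j * ((norm (y k))\<^sup>2 - (norm (A *v y k))\<^sup>2)" for k
    proof -
      have "?Q $ i $ j * (y k $ i - y k $ j)\<^sup>2 \<le> (\<Sum>j\<in>UNIV. ?Q $ i $ j * (y k $ i - y k $ j)\<^sup>2)"
        by (rule member_le_sum) (auto simp: gram_nonneg[OF A])
      also have "\<dots> \<le> (\<Sum>i\<in>UNIV. \<Sum>j\<in>UNIV. ?Q $ i $ j * (y k $ i - y k $ j)\<^sup>2)"
        by (rule member_le_sum[of i UNIV "\<lambda>i. \<Sum>j\<in>UNIV. ?Q $ i $ j * (y k $ i - y k $ j)\<^sup>2"])
          (auto simp: gram_nonneg[OF A] intro!: sum_nonneg)
      finally show ?thesis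
        using Q by (simp add: doubly_stochastic_norm_loss[OF A] field_simps)
    qed
    note le = this
    have "(\<lambda>k. 2 / ?Q $ i $ j * ((norm (y k))\<^sup>2 - (norm (A *v y k))\<^sup>2)) \<longlonglongrightarrow> 0"
      by (rule tendsto_mult_right_zero[OF lim])
    then have "(\<lambda>k. (y k $ i - y k $ j)\<^sup>2) \<longlonglongrightarrow> 0"
      by (rule Lim_null_comparison[rotated]) (simp add: le del: times_divide_eq_left)
    then show ?thesis
      by (rule tendsto_zero_if_power2)
  qed
  have "(i, j) \<in> (mat_edges ?Q)\<^sup>+"
    using irr by (simp add: irreducible_mat_def)
  then show ?thesis
  proof (induction rule: trancl_induct)
    case (base j)
    then show ?case by (rule edge)
  next
    case (step j l)
    from tendsto_add[OF step.IH edge[OF step.hyps(2)]] show ?case by simp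
  qed
qed

section \<open>Decay of the noise-free recursion\<close>

text \<open>From some \<open>N\<close> on the relative increments sum to less than 1/2. Enlarging
  all denominators \<open>r (Suc j)\<close> to the final \<open>r k\<close> only decreases this sum
  and makes it telescope to \<open>1 - r N / r k\<close>, so \<open>r\<close> at most doubles after
  \<open>N\<close>.\<close>

lemma bounded_if_summable_relative_increments:
  fixes r :: "nat \<Rightarrow> real"
  assumes pos: "\<And>k. r k > 0" and mono: "incseq r"
    and sum: "summable (\<lambda>k. 1 - r k / r (Suc k))"
  shows "\<exists>B. \<forall>k. r k \<le> B"
proof -
  obtain N where N: "norm (\<Sum>k=m..<n. 1 - r k / r (Suc k)) < 1/2" if "m \<ge> N" for m n
    using sum[unfolded summable_Cauchy, rule_format, of "1/2"] by auto
  have "r k \<le> 2 * r N" if "k \<ge> N" for k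
  proof -
    have "1 - r N / r k = (r k - r N) / r k"
      using pos[of k] by (simp add: diff_divide_distrib)
    also have "r k - r N = (\<Sum>j=N..<k. r (Suc j) - r j)"
      using that by (simp add: sum_Suc_diff')
    also have "\<dots> / r k \<le> (\<Sum>j=N..<k. 1 - r j / r (Suc j))"
      unfolding sum_divide_distrib
    proof (rule sum_mono)
      fix j assume j: "j \<in> {N..<k}"
      have "(r (Suc j) - r j) / r k \<le> (r (Suc j) - r j) / r (Suc j)"
        using j pos mono by (intro divide_left_mono) (auto simp: incseq_def)
      then show "(r (Suc j) - r j) / r k \<le> 1 - r j / r (Suc j)"
        using pos[of "Suc j"] by (simp add: diff_divide_distrib)
    qed
    finally have "1 - r N / r k < 1/2" using N[of N k] by simp
    then show ?thesis using pos[of k] by (simp add: field_simps)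
  qed
  then have "r k \<le> 2 * r N" for k
    using mono pos[of N] incseqD[OF mono, of k N] by (cases "k \<ge> N") (auto simp: less_imp_le intro: order.trans)
  then show ?thesis by blast
qed

text \<open>The recursion is assumed only from \<open>N\<close> on, so that trajectories whose noise
  stops at time \<open>N\<close> are covered.\<close>

lemma homogeneous_rls_tendsto_0:
  fixes A :: "real ^ 'n ^ 'n" and r :: "nat \<Rightarrow> 'n \<Rightarrow> real"
  assumes A: "doubly_stochastic A" and irr: "irreducible_mat (transpose A ** A)"
    and pos: "\<And>k i. r k i > 0" and mono: "\<And>i. incseq (\<lambda>k. r k i)"
    and div: "filterlim (\<lambda>k. \<Sum>i\<in>UNIV. r k i) at_top sequentially"
    and x: "\<And>k. k \<ge> N \<Longrightarrow> x (Suc k) = A *v (\<chi> i. r k i / r (Suc k) i * x k $ i)"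
  shows "x \<longlonglongrightarrow> 0"
proof -
  define d where "d k i = r k i / r (Suc k) i" for k i
  define y where "y k = (\<chi> i. d k i * x k $ i)" for k
  have d: "0 \<le> d k i" "d k i \<le> 1" for k i
    using pos[of k i] pos[of "Suc k" i] incseqD[OF mono, of k "Suc k" i] by (auto simp: d_def)
  have xy: "x (Suc k) = A *v y k" if "k \<ge> N" for k
    using x[OF that] by (simp add: y_def d_def)
  have loss: "(norm (x k))\<^sup>2 - (norm (y k))\<^sup>2 = (\<Sum>i\<in>UNIV. (1 - (d k i)\<^sup>2) * (x k $ i)\<^sup>2)" for k
    by (simp add: norm_vec_power2 y_def power_mult_distrib algebra_simps sum_subtractf)
  have d2: "1 - d k i \<le> 1 - (d k i)\<^sup>2" "0 \<le> 1 - (d k i)\<^sup>2" for k i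
    using d[of k i] mult_left_le[of "d k i" "d k i"] by (auto simp: power2_eq_square)
  have yx: "(norm (y k))\<^sup>2 \<le> (norm (x k))\<^sup>2" for k
  proof -
    have "0 \<le> (\<Sum>i\<in>UNIV. (1 - (d k i)\<^sup>2) * (x k $ i)\<^sup>2)"
      by (intro sum_nonneg mult_nonneg_nonneg d2) auto
    then show ?thesis using loss[of k] by linarith
  qed
  have Ay: "(norm (A *v y k))\<^sup>2 \<le> (norm (y k))\<^sup>2" for k
    using doubly_stochastic_norm_le[OF A] by simp
  define V where "V k = (norm (x (k + N)))\<^sup>2" for k
  have V_step: "V (Suc k) = (norm (A *v y (k + N)))\<^sup>2" for k
    by (simp add: V_def xy)
  have "decseq V"
    unfolding V_def by (intro decseq_SucI) (simp add: xy order.trans[OF Ay yx] del: power2_le_iff_abs_le)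
  then obtain v where v: "V \<longlonglongrightarrow> v"
    by (rule decseq_convergent[of V 0]) (auto simp: V_def)
  have V_bound: "V k \<le> V 0" for k
    using \<open>decseq V\<close> by (auto simp: decseq_def)
  have dV: "(\<lambda>k. V k - V (Suc k)) \<longlonglongrightarrow> 0"
    using tendsto_diff[OF v LIMSEQ_Suc[OF v]] by simp
  \<comment> \<open>The combination loss is one of two nonnegative summands of
    \<open>V k - V (Suc k)\<close>; the other is the adaptation loss.\<close>
  have "(\<lambda>k. (norm (y (k + N)))\<^sup>2 - (norm (A *v y (k + N)))\<^sup>2) \<longlonglongrightarrow> 0"
  proof (rule Lim_null_comparison[OF _ dV], intro always_eventually allI)
    fix k
    show "norm ((norm (y (k + N)))\<^sup>2 - (norm (A *v y (k + N)))\<^sup>2) \<le> V k - V (Suc k)"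
      unfolding V_step using Ay[of "k + N"] yx[of "k + N"] by (simp add: V_def del: power2_le_iff_abs_le)
  qed
  then have cons_y: "(\<lambda>k. y (k + N) $ i - y (k + N) $ j) \<longlonglongrightarrow> 0" for i j
    by (rule doubly_stochastic_consensus[OF A irr])
  have row: "(\<Sum>j\<in>UNIV. A $ i $ j) = 1" for i
    using A by (auto simp: doubly_stochastic_def)
  \<comment> \<open>Each component of the next \<open>x\<close> is a weighted mean of components of
    \<open>y\<close>, which agree in the limit. Comparing two components of \<open>x\<close> with
    the same \<open>l\<close> gives consensus of \<open>x\<close>.\<close>
  have near: "(\<lambda>k. x (Suc k + N) $ i - y (k + N) $ l) \<longlonglongrightarrow> 0" for i l
  proof -
    have "x (Suc k + N) $ i - y (k + N) $ l = (\<Sum>j\<in>UNIV. A $ i $ j * (y (k + N) $ j - y (k + N) $ l))" for k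
      by (simp add: xy matrix_vector_mult_def algebra_simps sum_subtractf row flip: sum_distrib_left sum_distrib_right)
    moreover have "(\<lambda>k. \<Sum>j\<in>UNIV. A $ i $ j * (y (k + N) $ j - y (k + N) $ l)) \<longlonglongrightarrow> 0"
      by (intro tendsto_null_sum tendsto_mult_right_zero cons_y)
    ultimately show ?thesis by simp
  qed
  have cons_x: "(\<lambda>k. x (k + N) $ i - x (k + N) $ j) \<longlonglongrightarrow> 0" for i j
    using tendsto_diff[OF near[of i i] near[of j i]] by (intro LIMSEQ_imp_Suc[where f = "\<lambda>k. x (k + N) $ i - x (k + N) $ j"]) simp
  have x_bound: "\<bar>x (k + N) $ i\<bar> \<le> sqrt (V 0)" for k i
    using component_le_norm_cart[of "x (k + N)" i] real_sqrt_le_mono[OF V_bound[of k]]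
    by (simp add: V_def)
  \<comment> \<open>A vanishing difference times a bounded sum is a difference of squares; these add
    up to \<open>V k\<close> minus \<open>CARD('n)\<close> times the squared component, so every
    component carries the same share of \<open>v\<close>.\<close>
  have comp: "(\<lambda>k. real CARD('n) * (x (k + N) $ i)\<^sup>2) \<longlonglongrightarrow> v" for i
  proof -
    have "(\<lambda>k. \<Sum>j\<in>UNIV. (x (k + N) $ j - x (k + N) $ i) * (x (k + N) $ j + x (k + N) $ i)) \<longlonglongrightarrow> 0"
    proof (rule tendsto_null_sum)
      fix j
      have "norm (x (k + N) $ j + x (k + N) $ i) \<le> sqrt (V 0) + sqrt (V 0)" for k
        unfolding real_norm_def
        by (rule order.trans[OF abs_triangle_ineq]) (intro add_mono x_bound)
      then show "(\<lambda>k. (x (k + N) $ j - x (k + N) $ i) * (x (k + N) $ j + x (k + N) $ i)) \<longlonglongrightarrow> 0"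
        by (intro lim_null_mult_right_bounded[OF cons_x] always_eventually allI)
    qed
    moreover have "(\<Sum>j\<in>UNIV. (x (k + N) $ j - x (k + N) $ i) * (x (k + N) $ j + x (k + N) $ i))
        = V k - real CARD('n) * (x (k + N) $ i)\<^sup>2" for k
    proof -
      have "(x (k + N) $ j - x (k + N) $ i) * (x (k + N) $ j + x (k + N) $ i)
          = (x (k + N) $ j)\<^sup>2 - (x (k + N) $ i)\<^sup>2" for j
        by (simp add: power2_eq_square algebra_simps)
      then show ?thesis
        by (simp add: V_def norm_vec_power2 sum_subtractf)
    qed
    ultimately show ?thesis
      using tendsto_diff[OF v, of "\<lambda>k. V k - real CARD('n) * (x (k + N) $ i)\<^sup>2" 0] by simp
  qed
  have "v \<ge> 0"
    by (rule LIMSEQ_le_const[OF v]) (auto simp: V_def)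
  have "v = 0"
  proof (rule ccontr)
    assume "v \<noteq> 0"
    with \<open>v \<ge> 0\<close> have "v > 0" by simp
    have "\<exists>B. \<forall>k. r k i \<le> B" for i
    proof (rule bounded_if_summable_relative_increments[OF pos mono])
      \<comment> \<open>The squared component tends to \<open>v / CARD('n)\<close> and so eventually
        exceeds half of it. The adaptation loss at node \<open>i\<close> is then at least
        \<open>c * (1 - d (k + N) i)\<close>, while the total losses telescope to a convergent
        series.\<close>
      define c where "c = v / 2 / real CARD('n)"
      have "c > 0" using \<open>v > 0\<close> by (simp add: c_def)
      have "eventually (\<lambda>k. real CARD('n) * (x (k + N) $ i)\<^sup>2 > v / 2) sequentially"
        using \<open>v > 0\<close> by (intro order_tendstoD(1)[OF comp]) auto
      then have "eventually (\<lambda>k. norm (1 - d (k + N) i) \<le> inverse c * (V k - V (Suc k))) sequentially"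
      proof eventually_elim
        case (elim k)
        have "c \<le> (x (k + N) $ i)\<^sup>2"
          using elim by (simp add: c_def field_simps)
        then have "c * (1 - d (k + N) i) \<le> (1 - (d (k + N) i)\<^sup>2) * (x (k + N) $ i)\<^sup>2"
          using \<open>c > 0\<close> d2[of "k + N" i] d(2)[of "k + N" i]
          by (subst mult.commute, intro mult_mono) auto
        also have "\<dots> \<le> (\<Sum>i\<in>UNIV. (1 - (d (k + N) i)\<^sup>2) * (x (k + N) $ i)\<^sup>2)"
          by (rule member_le_sum[of i UNIV "\<lambda>i. (1 - (d (k + N) i)\<^sup>2) * (x (k + N) $ i)\<^sup>2"])
            (auto simp: d2(2) simp del: diff_ge_0_iff_ge intro!: mult_nonneg_nonneg)
        also have "\<dots> \<le> V k - V (Suc k)"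
          unfolding V_step unfolding V_def using loss[of "k + N"] Ay[of "k + N"] by linarith
        finally show ?case
          using \<open>c > 0\<close> d(2)[of "k + N" i] by (simp add: field_simps)
      qed
      then have "summable (\<lambda>k. 1 - d (k + N) i)"
        by (rule summable_comparison_test_ev)
          (intro summable_mult telescope_summable'[OF v])
      then show "summable (\<lambda>k. 1 - r k i / r (Suc k) i)"
        by (subst (asm) summable_iff_shift) (simp add: d_def)
    qed
    then obtain B where B: "r k i \<le> B i" for k i
      by metis
    have "eventually (\<lambda>k. (\<Sum>i\<in>UNIV. r k i) > (\<Sum>i\<in>UNIV. B i)) sequentially"
      using div by (simp add: filterlim_at_top_dense)
    then obtain k where "(\<Sum>i\<in>UNIV. r k i) > (\<Sum>i\<in>UNIV. B i)"
      by (auto simp: eventually_sequentially)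
    moreover have "(\<Sum>i\<in>UNIV. r k i) \<le> (\<Sum>i\<in>UNIV. B i)"
      by (intro sum_mono B)
    ultimately show False by simp
  qed
  then have "(\<lambda>k. (norm (x (k + N)))\<^sup>2) \<longlonglongrightarrow> 0"
    using v by (simp add: V_def [abs_def])
  then have "(\<lambda>k. norm (x (k + N))) \<longlonglongrightarrow> 0"
    by (rule tendsto_zero_if_power2)
  then show ?thesis
    by (rule tendsto_norm_zero_cancel[OF LIMSEQ_offset])
qed

section \<open>Contractive recursions driven by independent noise\<close>

text \<open>The noise is a fixed path \<open>e\<close>, so the state is a function of the path, from
  which measurability and independence follow. The coefficient \<open>c\<close> may depend on the
  state so that a recursion frozen at a threshold is also an instance;
  \<open>\<lambda>_ _. 1\<close> gives additive noise.\<close>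

primrec driven ::
  "(nat \<Rightarrow> 'v \<Rightarrow> 'v) \<Rightarrow> (nat \<Rightarrow> 'v \<Rightarrow> real) \<Rightarrow> 'v \<Rightarrow> (nat \<Rightarrow> 'v) \<Rightarrow> nat \<Rightarrow> 'v::real_vector"
where
  "driven S c z e 0 = z"
| "driven S c z e (Suc k) = S k (driven S c z e k) + c k (driven S c z e k) *\<^sub>R e k"

lemma driven_cong:
  "(\<And>j. j < k \<Longrightarrow> e j = e' j) \<Longrightarrow> driven S c z e k = driven S c z e' k"
  by (induction k) auto

text \<open>Superposition serves to split the noise at a time \<open>N\<close>, and to cancel it
  between two trajectories that share it.\<close>

lemma driven_add:
  assumes "\<And>k. linear (T k)"
  shows "driven T (\<lambda>_ _. 1) (z + z') (\<lambda>j. e j + e' j) k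
       = driven T (\<lambda>_ _. 1) z e k + driven T (\<lambda>_ _. 1) z' e' k"
  by (induction k) (simp_all add: linear_add[OF assms])

text \<open>The state at time \<open>k\<close> depends only on the noise before \<open>k\<close>.
  Keeping \<open>n\<close> apart from \<open>k\<close> fixes the product space during the
  induction.\<close>

lemma driven_measurable_PiM:
  fixes z :: "'v::euclidean_space"
  assumes [measurable]: "\<And>k. S k \<in> borel_measurable borel" "\<And>k. c k \<in> borel_measurable borel"
  shows "k \<le> n \<Longrightarrow> (\<lambda>e. driven S c z e k) \<in> borel_measurable (PiM {..<n} (\<lambda>_. borel))"
proof (induction k)
  case (Suc k)
  then have [measurable]: "(\<lambda>e. driven S c z e k) \<in> borel_measurable (PiM {..<n} (\<lambda>_. borel))"
    by simp
  have [measurable]: "(\<lambda>e. e k) \<in> borel_measurable (PiM {..<n} (\<lambda>_. borel :: 'v measure))"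
    using Suc.prems by (intro measurable_component_singleton) auto
  show ?case by simp
qed simp

lemma driven_measurable:
  fixes z :: "'v::euclidean_space"
  assumes [measurable]: "\<And>k. S k \<in> borel_measurable borel" "\<And>k. c k \<in> borel_measurable borel"
    "\<And>k. w k \<in> borel_measurable M"
  shows "(\<lambda>\<omega>. driven S c z (\<lambda>j. w j \<omega>) k) \<in> borel_measurable M"
  by (induction k) simp_all

lemma norm_add_power2_le:
  fixes x y :: "'v::real_inner"
  shows "(norm (x + y))\<^sup>2 \<le> 2 * (norm x)\<^sup>2 + 2 * (norm y)\<^sup>2"
proof -
  have "(norm (x + y))\<^sup>2 + (norm (x - y))\<^sup>2 = 2 * (norm x)\<^sup>2 + 2 * (norm y)\<^sup>2"
    by (simp add: power2_norm_eq_inner inner_add_left inner_add_right inner_diff_left inner_diff_right)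
  then show ?thesis
    using zero_le_power2[of "norm (x - y)"] by linarith
qed

section \<open>Second moments, maximal inequality and convergence\<close>

context prob_space
begin

text \<open>The state is a function of the noise at indices below \<open>k\<close>, a block disjoint
  from \<open>{k}\<close>, and disjoint blocks of an independent family are independent.\<close>

lemma driven_indep:
  fixes z :: "'v::euclidean_space"
  assumes w: "indep_vars (\<lambda>_. borel) w UNIV"
    and meas: "\<And>k. S k \<in> borel_measurable borel" "\<And>k. c k \<in> borel_measurable borel"
    and f: "f \<in> borel_measurable borel" and g: "g \<in> borel_measurable borel"
  shows "indep_var borel (\<lambda>\<omega>. f (driven S c z (\<lambda>j. w j \<omega>) k)) borel (\<lambda>\<omega>. g (w k \<omega>))"
proof -
  let ?past = "\<lambda>\<omega>. restrict (\<lambda>j. w j \<omega>) {..<k}" and ?now = "\<lambda>\<omega>. restrict (\<lambda>j. w j \<omega>) {k}"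
  have "indep_var (PiM {..<k} (\<lambda>_. borel)) ?past (PiM {k} (\<lambda>_. borel)) ?now"
    by (rule indep_var_restrict[OF w]) auto
  moreover have "(\<lambda>e. f (driven S c z e k)) \<in> measurable (PiM {..<k} (\<lambda>_. borel)) borel"
    using driven_measurable_PiM[OF meas order_refl] f by (rule measurable_compose)
  moreover have "(\<lambda>e. g (e k)) \<in> measurable (PiM {k} (\<lambda>_. borel)) borel"
    using measurable_component_singleton g by (rule measurable_compose) simp
  ultimately have "indep_var borel ((\<lambda>e. f (driven S c z e k)) \<circ> ?past) borel ((\<lambda>e. g (e k)) \<circ> ?now)"
    by (rule indep_var_compose)
  moreover have "(\<lambda>e. f (driven S c z e k)) \<circ> ?past = (\<lambda>\<omega>. f (driven S c z (\<lambda>j. w j \<omega>) k))"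
    by (auto simp: fun_eq_iff intro!: arg_cong[where f = f] driven_cong)
  ultimately show ?thesis
    by (simp add: comp_def)
qed

lemma integrable_if_norm_power2_integrable:
  fixes X :: "'a \<Rightarrow> 'v::euclidean_space"
  assumes [measurable]: "X \<in> borel_measurable M" and X: "integrable M (\<lambda>\<omega>. (norm (X \<omega>))\<^sup>2)"
  shows "integrable M X"
proof (rule Bochner_Integration.integrable_bound[OF Bochner_Integration.integrable_add[OF integrable_const[of 1] X]])
  show "AE \<omega> in M. norm (X \<omega>) \<le> norm (1 + (norm (X \<omega>))\<^sup>2)"
    by (intro AE_I2) (smt (verit) norm_ge_zero self_le_power real_norm_def zero_less_numeral zero_le_power2)
qed simp

text \<open>Orthogonality as for martingale increments: the current noise has mean 0 and is
  independent of the current state, so the cross term vanishes in expectation. \<open>S\<close> and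
  \<open>c\<close> are general measurable maps so that frozen recursions are included.\<close>

lemma driven_second_moment:
  fixes z :: "'v::euclidean_space"
  assumes w: "indep_vars (\<lambda>_. borel) w UNIV"
    and mean: "\<And>k. expectation (w k) = 0"
    and sq: "\<And>k. integrable M (\<lambda>\<omega>. (norm (w k \<omega>))\<^sup>2)"
    and meas: "\<And>k. S k \<in> borel_measurable borel" "\<And>k. c k \<in> borel_measurable borel"
    and S: "\<And>k z. norm (S k z) \<le> norm z" and c: "\<And>k z. \<bar>c k z\<bar> \<le> 1"
  shows "integrable M (\<lambda>\<omega>. (norm (driven S c z (\<lambda>j. w j \<omega>) k))\<^sup>2) \<and>
    expectation (\<lambda>\<omega>. (norm (driven S c z (\<lambda>j. w j \<omega>) k))\<^sup>2)
      \<le> (norm z)\<^sup>2 + (\<Sum>j<k. expectation (\<lambda>\<omega>. (norm (w j \<omega>))\<^sup>2))"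
proof (induction k)
  case 0
  then show ?case by (simp add: prob_space)
next
  case (Suc k)
  have [measurable]: "w k \<in> borel_measurable M" for k
    using w by (auto simp: indep_vars_def)
  note meas [measurable]
  define Z where "Z \<omega> = driven S c z (\<lambda>j. w j \<omega>) k" for \<omega>
  have [measurable]: "Z \<in> borel_measurable M"
    unfolding Z_def by (rule driven_measurable) measurable
  have Z: "integrable M (\<lambda>\<omega>. (norm (Z \<omega>))\<^sup>2)"
    using Suc.IH by (simp add: Z_def)
  have wi: "integrable M (w k)"
    by (rule integrable_if_norm_power2_integrable[OF _ sq]) simp
  \<comment> \<open>Moving the noise coefficient to the state factor makes the cross term pair a
    function of the past with \<open>w k\<close> itself. The coefficient is at most 1 in size, so
    \<open>Z\<close> dominates \<open>X\<close> in norm.\<close>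
  define X where "X \<omega> = c k (Z \<omega>) *\<^sub>R S k (Z \<omega>)" for \<omega>
  have [measurable]: "X \<in> borel_measurable M"
    unfolding X_def[abs_def] by measurable
  have Xi: "integrable M X"
  proof (rule Bochner_Integration.integrable_bound[OF integrable_if_norm_power2_integrable[OF _ Z]])
    show "AE \<omega> in M. norm (X \<omega>) \<le> norm (Z \<omega>)"
      unfolding X_def norm_scaleR
      using mult_mono[OF c S] by (intro AE_I2) simp
  qed simp_all
  have orth: "integrable M (\<lambda>\<omega>. X \<omega> \<bullet> w k \<omega>)" "expectation (\<lambda>\<omega>. X \<omega> \<bullet> w k \<omega>) = 0"
  proof -
    \<comment> \<open>The product rule for independent variables is applied to real coordinates; the
      inner product is their sum over \<open>Basis\<close>.\<close>
    have *: "integrable M (\<lambda>\<omega>. (X \<omega> \<bullet> b) * (w k \<omega> \<bullet> b)) \<and> expectation (\<lambda>\<omega>. (X \<omega> \<bullet> b) * (w k \<omega> \<bullet> b)) = 0" for b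
    proof -
      have ind: "indep_var borel (\<lambda>\<omega>. X \<omega> \<bullet> b) borel (\<lambda>\<omega>. w k \<omega> \<bullet> b)"
        unfolding X_def Z_def
        by (rule driven_indep[OF w meas, where f = "\<lambda>z. (c k z *\<^sub>R S k z) \<bullet> b" and g = "\<lambda>z. z \<bullet> b"]) simp_all
      have "expectation (\<lambda>\<omega>. w k \<omega> \<bullet> b) = 0"
        by (simp add: wi mean)
      then show ?thesis
        using indep_var_integrable[OF ind] indep_var_lebesgue_integral[OF ind] Xi wi by simp
    qed
    have "(\<lambda>\<omega>. X \<omega> \<bullet> w k \<omega>) = (\<lambda>\<omega>. \<Sum>b\<in>Basis. (X \<omega> \<bullet> b) * (w k \<omega> \<bullet> b))"
      by (rule ext) (rule euclidean_inner)
    then show "integrable M (\<lambda>\<omega>. X \<omega> \<bullet> w k \<omega>)" "expectation (\<lambda>\<omega>. X \<omega> \<bullet> w k \<omega>) = 0"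
      using * by simp_all
  qed
  let ?Y = "\<lambda>\<omega>. driven S c z (\<lambda>j. w j \<omega>) (Suc k)"
  let ?B = "\<lambda>\<omega>. (norm (Z \<omega>))\<^sup>2 + 2 * (X \<omega> \<bullet> w k \<omega>) + (norm (w k \<omega>))\<^sup>2"
  have le: "(norm (?Y \<omega>))\<^sup>2 \<le> ?B \<omega>" for \<omega>
  proof -
    have "(norm (?Y \<omega>))\<^sup>2 = (norm (S k (Z \<omega>)))\<^sup>2 + 2 * (X \<omega> \<bullet> w k \<omega>) + (norm (c k (Z \<omega>) *\<^sub>R w k \<omega>))\<^sup>2"
      by (simp add: X_def Z_def power2_norm_eq_inner inner_add_left inner_add_right inner_commute del: norm_scaleR)
    moreover have "(norm (S k (Z \<omega>)))\<^sup>2 \<le> (norm (Z \<omega>))\<^sup>2"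
      using S by simp
    moreover have "(norm (c k (Z \<omega>) *\<^sub>R w k \<omega>))\<^sup>2 \<le> (norm (w k \<omega>))\<^sup>2"
      using c[of k "Z \<omega>"] by (intro power_mono) (auto simp: mult_left_le_one_le)
    ultimately show ?thesis by linarith
  qed
  have B: "integrable M ?B"
    by (intro Bochner_Integration.integrable_add integrable_mult_right Z orth sq)
  have Y: "integrable M (\<lambda>\<omega>. (norm (?Y \<omega>))\<^sup>2)"
  proof (rule Bochner_Integration.integrable_bound[OF B])
    show "AE \<omega> in M. norm ((norm (?Y \<omega>))\<^sup>2) \<le> norm (?B \<omega>)"
    proof (rule AE_I2)
      fix \<omega>
      show "norm ((norm (?Y \<omega>))\<^sup>2) \<le> norm (?B \<omega>)"
        using order.trans[OF le[of \<omega>] abs_ge_self] by (simp del: driven.simps)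
    qed
    have "?Y \<in> borel_measurable M"
      by (rule driven_measurable) measurable
    then show "(\<lambda>\<omega>. (norm (?Y \<omega>))\<^sup>2) \<in> borel_measurable M"
      by measurable
  qed
  have "expectation (\<lambda>\<omega>. (norm (?Y \<omega>))\<^sup>2) \<le> expectation ?B"
    by (rule integral_mono[OF Y B le])
  also have "\<dots> = expectation (\<lambda>\<omega>. (norm (Z \<omega>))\<^sup>2) + expectation (\<lambda>\<omega>. (norm (w k \<omega>))\<^sup>2)"
    using Z orth sq by simp
  finally show ?case
    using Suc.IH Y by (simp add: Z_def del: driven.simps)
qed

text \<open>
  Freezing the recursion once its norm reaches \<open>c\<close> yields a recursion of the same kind,
  so the second moment bound gives a maximal inequality.
\<close>

lemma driven_maximal_inequality:
  fixes w :: "nat \<Rightarrow> 'a \<Rightarrow> 'v::euclidean_space"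
  assumes w: "indep_vars (\<lambda>_. borel) w UNIV"
    and mean: "\<And>k. expectation (w k) = 0"
    and sq: "\<And>k. integrable M (\<lambda>\<omega>. (norm (w k \<omega>))\<^sup>2)"
    and meas: "\<And>k. T k \<in> borel_measurable borel"
    and T: "\<And>k z. norm (T k z) \<le> norm z"
    and summ: "summable (\<lambda>k. expectation (\<lambda>\<omega>. (norm (w k \<omega>))\<^sup>2))"
    and "c > 0"
  shows "prob {\<omega> \<in> space M. \<exists>k. c \<le> norm (driven T (\<lambda>_ _. 1) 0 (\<lambda>j. w j \<omega>) k)}
    \<le> (\<Sum>k. expectation (\<lambda>\<omega>. (norm (w k \<omega>))\<^sup>2)) / c\<^sup>2"
proof -
  define S where "S k z = (if c \<le> norm z then z else T k z)" for k z
  define h where "h k z = (if c \<le> norm z then 0 else 1 :: real)" for k :: nat and z :: 'v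
  have [measurable]: "w k \<in> borel_measurable M" for k
    using w by (auto simp: indep_vars_def)
  note meas [measurable]
  let ?z = "\<lambda>k \<omega>. driven T (\<lambda>_ _. 1) 0 (\<lambda>j. w j \<omega>) k"
  let ?s = "\<lambda>k \<omega>. driven S h 0 (\<lambda>j. w j \<omega>) k"
  have S_meas: "S k \<in> borel_measurable borel" and h_meas: "h k \<in> borel_measurable borel" for k
    unfolding S_def h_def by measurable
  have frozen: "if \<exists>j\<le>k. c \<le> norm (?z j \<omega>) then c \<le> norm (?s k \<omega>) else ?s k \<omega> = ?z k \<omega>" for k \<omega>
    by (induction k) (auto simp: S_def h_def le_Suc_eq split: if_splits)
  define E where "E k = {\<omega> \<in> space M. \<exists>j\<le>k. c \<le> norm (?z j \<omega>)}" for k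
  have [measurable]: "(\<lambda>\<omega>. ?z k \<omega>) \<in> borel_measurable M" for k
    by (rule driven_measurable) measurable
  have E_sets: "E k \<in> sets M" for k
    unfolding E_def by measurable
  have "prob (E k) \<le> (\<Sum>k. expectation (\<lambda>\<omega>. (norm (w k \<omega>))\<^sup>2)) / c\<^sup>2" for k
  proof -
    have moment: "integrable M (\<lambda>\<omega>. (norm (?s k \<omega>))\<^sup>2)"
      "expectation (\<lambda>\<omega>. (norm (?s k \<omega>))\<^sup>2) \<le> (\<Sum>j<k. expectation (\<lambda>\<omega>. (norm (w j \<omega>))\<^sup>2))"
      using driven_second_moment[OF w mean sq S_meas h_meas, where z = 0 and k = k] T by (auto simp: S_def h_def)
    have [measurable]: "(\<lambda>\<omega>. ?s k \<omega>) \<in> borel_measurable M"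
      by (rule driven_measurable[OF S_meas h_meas]) measurable
    have "E k \<subseteq> {\<omega> \<in> space M. (norm (?s k \<omega>))\<^sup>2 \<ge> c\<^sup>2}"
    proof
      fix \<omega> assume "\<omega> \<in> E k"
      then have "\<omega> \<in> space M" "c \<le> norm (?s k \<omega>)"
        using frozen[of k \<omega>] by (auto simp: E_def split: if_splits)
      then show "\<omega> \<in> {\<omega> \<in> space M. (norm (?s k \<omega>))\<^sup>2 \<ge> c\<^sup>2}"
        using \<open>c > 0\<close> by (auto intro: power_mono)
    qed
    then have "prob (E k) \<le> prob {\<omega> \<in> space M. (norm (?s k \<omega>))\<^sup>2 \<ge> c\<^sup>2}"
      by (intro finite_measure_mono) auto
    also have "\<dots> \<le> expectation (\<lambda>\<omega>. (norm (?s k \<omega>))\<^sup>2) / c\<^sup>2"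
      using \<open>c > 0\<close> by (intro integral_Markov_inequality_measure[OF moment(1) sets.top]) auto
    also have "\<dots> \<le> (\<Sum>k. expectation (\<lambda>\<omega>. (norm (w k \<omega>))\<^sup>2)) / c\<^sup>2"
      using moment(2) sum_le_suminf[OF summ, of "{..<k}"]
      by (intro divide_right_mono) (auto intro: order.trans)
    finally show ?thesis .
  qed
  moreover have "(\<lambda>k. prob (E k)) \<longlonglongrightarrow> prob (\<Union>k. E k)"
    using E_sets by (intro finite_Lim_measure_incseq) (auto simp: incseq_def E_def intro: order.trans)
  ultimately have "prob (\<Union>k. E k) \<le> (\<Sum>k. expectation (\<lambda>\<omega>. (norm (w k \<omega>))\<^sup>2)) / c\<^sup>2"
    by (intro LIMSEQ_le_const2[where X = "\<lambda>k. prob (E k)"]) auto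
  also have "(\<Union>k. E k) = {\<omega> \<in> space M. \<exists>k. c \<le> norm (?z k \<omega>)}"
    by (auto simp: E_def)
  finally show ?thesis .
qed

text \<open>\<open>stable\<close> is required from any starting time because the part driven by the
  noise before \<open>N\<close> is noise-free only from \<open>N\<close> on.\<close>

lemma driven_tendsto_0:
  fixes w :: "nat \<Rightarrow> 'a \<Rightarrow> 'v::euclidean_space"
  assumes w: "indep_vars (\<lambda>_. borel) w UNIV"
    and mean: "\<And>k. expectation (w k) = 0"
    and sq: "\<And>k. integrable M (\<lambda>\<omega>. (norm (w k \<omega>))\<^sup>2)"
    and summ: "summable (\<lambda>k. expectation (\<lambda>\<omega>. (norm (w k \<omega>))\<^sup>2))"
    and lin: "\<And>k. linear (T k)" and T: "\<And>k z. norm (T k z) \<le> norm z"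
    and stable: "\<And>x N. (\<And>k. k \<ge> N \<Longrightarrow> x (Suc k) = T k (x k)) \<Longrightarrow> x \<longlonglongrightarrow> 0"
  shows "AE \<omega> in M. (\<lambda>k. driven T (\<lambda>_ _. 1) z (\<lambda>j. w j \<omega>) k) \<longlonglongrightarrow> 0"
    and "(\<lambda>k. \<integral>\<^sup>+ \<omega>. ennreal ((norm (driven T (\<lambda>_ _. 1) z (\<lambda>j. w j \<omega>) k))\<^sup>2) \<partial>M) \<longlonglongrightarrow> 0"
proof -
  have [measurable]: "T k \<in> borel_measurable borel" for k
    using lin by (intro borel_measurable_continuous_onI linear_continuous_on linear_linear[THEN iffD2])
  have T_meas: "T k \<in> borel_measurable borel" for k
    by measurable
  have one_meas: "(\<lambda>_. 1 :: real) \<in> borel_measurable (borel :: 'v measure)"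
    by measurable
  have w_meas [measurable]: "w k \<in> borel_measurable M" for k
    using w by (auto simp: indep_vars_def)
  define x where "x k \<omega> = driven T (\<lambda>_ _. 1) z (\<lambda>j. w j \<omega>) k" for k \<omega>
  \<comment> \<open>The initial value goes with the head; the tail starts at 0, as in the maximal
    inequality.\<close>
  define head where "head N j \<omega> = (if j < N then w j \<omega> else 0)" for N j \<omega>
  define tail where "tail N j \<omega> = (if j < N then 0 else w j \<omega>)" for N j \<omega>
  define a where "a N k \<omega> = driven T (\<lambda>_ _. 1) z (\<lambda>j. head N j \<omega>) k" for N k \<omega>
  define v where "v N k \<omega> = driven T (\<lambda>_ _. 1) 0 (\<lambda>j. tail N j \<omega>) k" for N k \<omega>
  have split: "x k \<omega> = a N k \<omega> + v N k \<omega>" for N k \<omega>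
  proof -
    have "w j \<omega> = head N j \<omega> + tail N j \<omega>" for j
      by (simp add: head_def tail_def)
    then show ?thesis
      using driven_add[of T z 0 "\<lambda>j. head N j \<omega>" "\<lambda>j. tail N j \<omega>" k] lin
      by (simp add: x_def a_def v_def)
  qed
  have [measurable]: "x k \<in> borel_measurable M" for k
    unfolding x_def by (rule driven_measurable) measurable
  have head_meas [measurable]: "head N j \<in> borel_measurable M"
    and tail_meas [measurable]: "tail N j \<in> borel_measurable M" for N j
    unfolding head_def tail_def by measurable
  have a_meas [measurable]: "a N k \<in> borel_measurable M"
    and v_meas [measurable]: "v N k \<in> borel_measurable M" for N k
    unfolding a_def v_def by (rule driven_measurable; measurable)+
  have a_lim: "(\<lambda>k. a N k \<omega>) \<longlonglongrightarrow> 0" for N \<omega>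
    by (rule stable[of N]) (simp add: a_def head_def)
  have tail_indep: "indep_vars (\<lambda>_. borel) (tail N) UNIV" for N
    using indep_vars_compose2[OF w, of "\<lambda>j x. if j < N then 0 else x" "\<lambda>_. borel"]
    by (simp add: tail_def[abs_def])
  define b where "b k = expectation (\<lambda>\<omega>. (norm (w k \<omega>))\<^sup>2)" for k
  have b_nonneg: "b k \<ge> 0" for k
    by (simp add: b_def)
  have tail_mean: "expectation (tail N k) = 0"
    and tail_sq: "integrable M (\<lambda>\<omega>. (norm (tail N k \<omega>))\<^sup>2)"
    and tail_b: "expectation (\<lambda>\<omega>. (norm (tail N k \<omega>))\<^sup>2) = (if k < N then 0 else b k)" for N k
  proof -
    have "tail N k = (if k < N then \<lambda>_. 0 else w k)"
      by (auto simp: tail_def)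
    then show "expectation (tail N k) = 0" "integrable M (\<lambda>\<omega>. (norm (tail N k \<omega>))\<^sup>2)"
      "expectation (\<lambda>\<omega>. (norm (tail N k \<omega>))\<^sup>2) = (if k < N then 0 else b k)"
      using mean sq by (simp_all add: b_def)
  qed
  have summ_b: "summable b"
    using summ by (simp add: b_def[abs_def])
  define t where "t N = (\<Sum>k. b (k + N))" for N
  have t_lim: "t \<longlonglongrightarrow> 0"
    unfolding t_def by (rule suminf_exist_split2[OF summ_b])
  have tail_sums: "(\<lambda>k. expectation (\<lambda>\<omega>. (norm (tail N k \<omega>))\<^sup>2)) sums t N" for N
  proof -
    have "(\<lambda>k. b (k + N)) sums t N"
      unfolding t_def by (intro summable_sums) (simp add: summable_iff_shift summ_b)
    then show ?thesis
      using sums_iff_shift[of "\<lambda>k. if k < N then 0 else b k" N "t N"] by (simp add: tail_b)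
  qed
  have v_sq: "integrable M (\<lambda>\<omega>. (norm (v N k \<omega>))\<^sup>2)"
    and v_le: "expectation (\<lambda>\<omega>. (norm (v N k \<omega>))\<^sup>2) \<le> t N" for N k
  proof -
    have moment: "integrable M (\<lambda>\<omega>. (norm (v N k \<omega>))\<^sup>2)"
      "expectation (\<lambda>\<omega>. (norm (v N k \<omega>))\<^sup>2) \<le> (\<Sum>j<k. expectation (\<lambda>\<omega>. (norm (tail N j \<omega>))\<^sup>2))"
      using driven_second_moment[OF tail_indep[of N] tail_mean tail_sq T_meas one_meas T, where z = 0 and k = k]
      by (simp_all add: v_def)
    moreover have "(\<Sum>j<k. expectation (\<lambda>\<omega>. (norm (tail N j \<omega>))\<^sup>2)) \<le> t N"
      using sum_le_suminf[OF sums_summable[OF tail_sums[of N]], of "{..<k}"] sums_unique[OF tail_sums, of N]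
      by simp
    ultimately show "integrable M (\<lambda>\<omega>. (norm (v N k \<omega>))\<^sup>2)"
      "expectation (\<lambda>\<omega>. (norm (v N k \<omega>))\<^sup>2) \<le> t N"
      by simp_all
  qed
  show "AE \<omega> in M. (\<lambda>k. driven T (\<lambda>_ _. 1) z (\<lambda>j. w j \<omega>) k) \<longlonglongrightarrow> 0"
  proof -
    have small: "AE \<omega> in M. eventually (\<lambda>k. norm (x k \<omega>) < 2 * c) sequentially" if "c > 0" for c
    proof -
      \<comment> \<open>The probability of \<open>Bad N\<close> tends to 0 with \<open>t N\<close>,
        so almost every \<open>\<omega>\<close> lies outside \<open>Bad N\<close> for at least one
        \<open>N\<close>. With that \<open>N\<close> the tail stays below \<open>c\<close> and the
        head eventually does, hence the bound \<open>2 * c\<close>.\<close>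
      define Bad where "Bad N = {\<omega> \<in> space M. \<exists>k. c \<le> norm (v N k \<omega>)}" for N
      have Bad_sets: "Bad N \<in> sets M" for N
        unfolding Bad_def by measurable
      have Bad_prob: "prob (Bad N) \<le> t N / c\<^sup>2" for N
        using driven_maximal_inequality[OF tail_indep[of N] tail_mean tail_sq T_meas T
            sums_summable[OF tail_sums] \<open>c > 0\<close>] sums_unique[OF tail_sums, of N]
        by (simp add: Bad_def v_def)
      have "prob (\<Inter>N. Bad N) \<le> 0"
      proof (rule LIMSEQ_le_const)
        show "(\<lambda>N. t N / c\<^sup>2) \<longlonglongrightarrow> 0"
          using tendsto_divide[OF t_lim tendsto_const, of "c\<^sup>2"] \<open>c > 0\<close> by simp
        have "prob (\<Inter>N. Bad N) \<le> t N / c\<^sup>2" for N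
          using finite_measure_mono[of "\<Inter>N. Bad N" "Bad N"] Bad_sets Bad_prob[of N]
          by (auto intro: order.trans)
        then show "\<exists>N. \<forall>n\<ge>N. prob (\<Inter>N. Bad N) \<le> t n / c\<^sup>2"
          by blast
      qed
      then have "prob (\<Inter>N. Bad N) = 0"
        using measure_nonneg[of M "\<Inter>N. Bad N"] by linarith
      moreover have "(\<Inter>N. Bad N) \<in> sets M"
        using Bad_sets by (intro sets.countable_INT) auto
      ultimately have "AE \<omega> in M. \<omega> \<notin> (\<Inter>N. Bad N)"
        by (intro AE_not_in) (auto simp: null_sets_def emeasure_eq_measure)
      with AE_space show ?thesis
      proof eventually_elim
        case (elim \<omega>)
        then obtain N where N: "\<omega> \<notin> Bad N" by blast
        have v: "norm (v N k \<omega>) < c" for k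
          using N elim by (auto simp: Bad_def not_le)
        have "eventually (\<lambda>k. norm (a N k \<omega>) < c) sequentially"
          using order_tendstoD(2)[OF tendsto_norm[OF a_lim[of N \<omega>]], of c] \<open>c > 0\<close> by simp
        then show ?case
        proof eventually_elim
          case (elim k)
          then show ?case
            using v[of k] norm_triangle_ineq[of "a N k \<omega>" "v N k \<omega>"] by (simp add: split[of k \<omega> N])
        qed
      qed
    qed
    \<comment> \<open>Thresholds from a sequence tending to 0 keep the union of the exceptional null
      sets countable.\<close>
    have "AE \<omega> in M. \<forall>n. eventually (\<lambda>k. norm (x k \<omega>) < 2 * inverse (real (Suc n))) sequentially"
      using small by (subst AE_all_countable) simp
    then show ?thesis
    proof eventually_elim
      case (elim \<omega>)
      have "(\<lambda>k. x k \<omega>) \<longlonglongrightarrow> 0"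
      proof (rule tendstoI)
        fix c :: real assume "c > 0"
        then obtain n where n: "inverse (real (Suc n)) < c / 2"
          using reals_Archimedean[of "c / 2"] by auto
        show "eventually (\<lambda>k. dist (x k \<omega>) 0 < c) sequentially"
          using elim[rule_format, of n] by eventually_elim (use n in simp)
      qed
      then show ?case by (simp add: x_def)
    qed
  qed
  show "(\<lambda>k. \<integral>\<^sup>+ \<omega>. ennreal ((norm (driven T (\<lambda>_ _. 1) z (\<lambda>j. w j \<omega>) k))\<^sup>2) \<partial>M) \<longlonglongrightarrow> 0"
  proof -
    \<comment> \<open>At time \<open>N\<close> the head has used the same noise as the full
      trajectory; afterwards it is noise-free and cannot grow. So \<open>x N\<close> dominates it,
      and dominated convergence applies with \<open>N\<close> fixed.\<close>
    have a_norm: "norm (a N (k + N) \<omega>) \<le> norm (x N \<omega>)" for N k \<omega>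
    proof (induction k)
      case 0
      have "a N N \<omega> = x N \<omega>"
        unfolding a_def x_def by (rule driven_cong) (simp add: head_def)
      then show ?case by simp
    next
      case (Suc k)
      have "norm (a N (Suc k + N) \<omega>) \<le> norm (a N (k + N) \<omega>)"
        by (simp add: a_def head_def T)
      with Suc show ?case by simp
    qed
    have x_sq: "integrable M (\<lambda>\<omega>. (norm (x N \<omega>))\<^sup>2)" for N
      using driven_second_moment[OF w mean sq T_meas one_meas T, where z = z and k = N]
      by (simp add: x_def)
    have a_sq: "(\<lambda>k. expectation (\<lambda>\<omega>. (norm (a N (k + N) \<omega>))\<^sup>2)) \<longlonglongrightarrow> 0"
      and a_int: "integrable M (\<lambda>\<omega>. (norm (a N (k + N) \<omega>))\<^sup>2)" for N k
    proof -
      have le: "norm ((norm (a N (k + N) \<omega>))\<^sup>2) \<le> (norm (x N \<omega>))\<^sup>2" for k \<omega>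
        using a_norm by simp
      have "(\<lambda>k. expectation (\<lambda>\<omega>. (norm (a N (k + N) \<omega>))\<^sup>2)) \<longlonglongrightarrow> expectation (\<lambda>_. 0)"
      proof (rule integral_dominated_convergence[where w = "\<lambda>\<omega>. (norm (x N \<omega>))\<^sup>2"])
        have "(\<lambda>k. (norm (a N (k + N) \<omega>))\<^sup>2) \<longlonglongrightarrow> 0" for \<omega>
          by (intro tendsto_null_power tendsto_norm_zero LIMSEQ_ignore_initial_segment a_lim) simp
        then show "AE \<omega> in M. (\<lambda>k. (norm (a N (k + N) \<omega>))\<^sup>2) \<longlonglongrightarrow> 0"
          by simp
      qed (use le x_sq in auto)
      then show "(\<lambda>k. expectation (\<lambda>\<omega>. (norm (a N (k + N) \<omega>))\<^sup>2)) \<longlonglongrightarrow> 0"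
        by simp
      show "integrable M (\<lambda>\<omega>. (norm (a N (k + N) \<omega>))\<^sup>2)"
      proof (rule Bochner_Integration.integrable_bound[OF x_sq])
        show "AE \<omega> in M. norm ((norm (a N (k + N) \<omega>))\<^sup>2) \<le> norm ((norm (x N \<omega>))\<^sup>2)"
          using le by simp
      qed measurable
    qed
    have "(\<lambda>k. expectation (\<lambda>\<omega>. (norm (x k \<omega>))\<^sup>2)) \<longlonglongrightarrow> 0"
    proof (rule tendstoI)
      fix c :: real assume "c > 0"
      \<comment> \<open>The squared norm of a sum is at most twice the sum of the squared norms, so
        head and tail may each contribute \<open>c / 4\<close>.\<close>
      then have "eventually (\<lambda>N. t N < c / 4) sequentially"
        by (intro order_tendstoD(2)[OF t_lim]) simp
      then obtain N where N: "t N < c / 4"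
        by (auto simp: eventually_sequentially)
      have "eventually (\<lambda>k. expectation (\<lambda>\<omega>. (norm (a N (k + N) \<omega>))\<^sup>2) < c / 4) sequentially"
        using \<open>c > 0\<close> by (intro order_tendstoD(2)[OF a_sq]) simp
      then have "eventually (\<lambda>k. dist (expectation (\<lambda>\<omega>. (norm (x (k + N) \<omega>))\<^sup>2)) 0 < c) sequentially"
      proof eventually_elim
        case (elim k)
        have "expectation (\<lambda>\<omega>. (norm (x (k + N) \<omega>))\<^sup>2)
            \<le> expectation (\<lambda>\<omega>. 2 * (norm (a N (k + N) \<omega>))\<^sup>2 + 2 * (norm (v N (k + N) \<omega>))\<^sup>2)"
          by (intro integral_mono x_sq Bochner_Integration.integrable_add integrable_mult_right a_int v_sq)
            (simp add: split[of _ _ N] norm_add_power2_le)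
        also have "\<dots> = 2 * expectation (\<lambda>\<omega>. (norm (a N (k + N) \<omega>))\<^sup>2)
            + 2 * expectation (\<lambda>\<omega>. (norm (v N (k + N) \<omega>))\<^sup>2)"
          using a_int v_sq by simp
        also have "\<dots> < c"
          using elim N v_le[of N "k + N"] by linarith
        finally show ?case by simp
      qed
      then show "eventually (\<lambda>k. dist (expectation (\<lambda>\<omega>. (norm (x k \<omega>))\<^sup>2)) 0 < c) sequentially"
        by (subst (asm) eventually_sequentially_seg)
    qed
    then have "(\<lambda>k. ennreal (expectation (\<lambda>\<omega>. (norm (x k \<omega>))\<^sup>2))) \<longlonglongrightarrow> 0"
      using tendsto_ennrealI by fastforce
    then show ?thesis
      using x_sq by (simp add: nn_integral_eq_integral x_def)
  qed
qed

end

section \<open>Diffusion recursive least squares\<close>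

definition rls_transition ::
  "real ^ 'n ^ 'n \<Rightarrow> (nat \<Rightarrow> real ^ 'n) \<Rightarrow> nat \<Rightarrow> real ^ 'n \<Rightarrow> real ^ 'n" where
  "rls_transition A \<phi> k z =
     A *v (\<chi> i. inverse (rls_P \<phi> k i) / inverse (rls_P \<phi> (Suc k) i) * z $ i)"

definition rls_noise ::
  "real ^ 'n ^ 'n \<Rightarrow> (nat \<Rightarrow> real ^ 'n) \<Rightarrow> nat \<Rightarrow> real ^ 'n \<Rightarrow> real ^ 'n" where
  "rls_noise A \<phi> k e = A *v (\<chi> i. rls_L \<phi> k i * e $ i)"

lemma inverse_rls_P_Suc: "inverse (rls_P \<phi> (Suc k) i) = inverse (rls_P \<phi> k i) + (\<phi> k $ i)\<^sup>2"
  by (simp add: rls_P_def power2_eq_square)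

lemma inverse_rls_P_ge_1: "inverse (rls_P \<phi> k i) \<ge> 1"
  by (simp add: rls_P_def sum_nonneg)

lemma inverse_rls_P_pos: "inverse (rls_P \<phi> k i) > 0"
  using inverse_rls_P_ge_1[of \<phi> k i] by linarith

lemma rls_P_pos: "rls_P \<phi> k i > 0"
  using inverse_rls_P_pos[of \<phi> k i] by simp

lemma incseq_inverse_rls_P: "incseq (\<lambda>k. inverse (rls_P \<phi> k i))"
  by (rule incseq_SucI) (simp add: inverse_rls_P_Suc del: inverse_inverse_eq)

text \<open>The factor by which adaptation shrinks the error is a ratio of successive inverse gains,
  the form in which products over time telescope.\<close>

lemma rls_decay_eq:
  "inverse (rls_P \<phi> k i) / inverse (rls_P \<phi> (Suc k) i) = 1 - rls_L \<phi> k i * \<phi> k $ i"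
proof -
  have "inverse (rls_P \<phi> k i) = inverse (rls_P \<phi> (Suc k) i) - (\<phi> k $ i)\<^sup>2"
    by (simp add: inverse_rls_P_Suc)
  then show ?thesis
    using rls_P_pos[of \<phi> "Suc k" i] by (simp add: rls_L_def field_simps power2_eq_square)
qed

lemma rls_decay_bounds:
  "0 < inverse (rls_P \<phi> k i) / inverse (rls_P \<phi> (Suc k) i)"
  "inverse (rls_P \<phi> k i) / inverse (rls_P \<phi> (Suc k) i) \<le> 1"
  using inverse_rls_P_pos[of \<phi> k i] inverse_rls_P_pos[of \<phi> "Suc k" i]
    incseqD[OF incseq_inverse_rls_P, of k "Suc k" \<phi> i]
  by (auto simp del: inverse_positive_iff_positive)

lemma linear_matrix_scale: "linear (\<lambda>z :: real ^ 'n. A *v (\<chi> i. c i * z $ i))"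
  by (rule linearI)
    (simp_all add: vec_eq_iff matrix_vector_mult_def algebra_simps sum.distrib sum_distrib_left)

lemma linear_rls_transition: "linear (rls_transition A \<phi> k)"
  unfolding rls_transition_def[abs_def] by (rule linear_matrix_scale)

lemma linear_rls_noise: "linear (rls_noise A \<phi> k)"
  unfolding rls_noise_def[abs_def] by (rule linear_matrix_scale)

lemma norm_rls_transition_le:
  assumes "doubly_stochastic A"
  shows "norm (rls_transition A \<phi> k z) \<le> norm z"
proof -
  have "norm (\<chi> i. inverse (rls_P \<phi> k i) / inverse (rls_P \<phi> (Suc k) i) * z $ i) \<le> norm z"
  proof (rule norm_le_componentwise_cart)
    fix i
    show "norm ((\<chi> i. inverse (rls_P \<phi> k i) / inverse (rls_P \<phi> (Suc k) i) * z $ i) $ i) \<le> norm (z $ i)"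
      using mult_right_mono[OF rls_decay_bounds(2)[of \<phi> k i] abs_ge_zero[of "z $ i"]]
        rls_decay_bounds(1)[of \<phi> k i]
      by (simp only: vec_lambda_beta real_norm_def abs_mult abs_of_pos mult_1)
  qed
  then show ?thesis
    unfolding rls_transition_def using doubly_stochastic_norm_le[OF assms] by (rule order.trans[rotated])
qed

text \<open>Row sums 1 make constant vectors fixed points of \<open>A\<close>, so the true parameter
  can be subtracted before the combination step; the signal part of the observation then merges into
  the decay factor.\<close>

lemma rls_error_eq_driven:
  assumes "doubly_stochastic A"
  shows "rls_error A \<theta> \<phi> \<epsilon> \<Theta>\<^sub>0 k \<omega> =
    driven (rls_transition A \<phi>) (\<lambda>_ _. 1) (\<Theta>\<^sub>0 - (\<chi> i. \<theta>)) (\<lambda>j. rls_noise A \<phi> j (\<epsilon> j \<omega>)) k"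
proof (induction k)
  case 0
  then show ?case by (simp add: rls_error_def)
next
  case (Suc k)
  let ?x = "rls_error A \<theta> \<phi> \<epsilon> \<Theta>\<^sub>0 k \<omega>" and ?y = "observation \<theta> \<phi> \<epsilon> \<omega>"
  let ?\<Theta> = "diffusion_rls A \<phi> ?y \<Theta>\<^sub>0 k"
  have "A *v (\<chi> i. \<theta>) = (\<chi> i. \<theta>)"
    using assms by (simp add: vec_eq_iff matrix_vector_mult_def doubly_stochastic_def flip: sum_distrib_right)
  then have "rls_error A \<theta> \<phi> \<epsilon> \<Theta>\<^sub>0 (Suc k) \<omega> = A *v (rls_adapt \<phi> ?y k ?\<Theta> - (\<chi> i. \<theta>))"
    by (simp add: rls_error_def matrix_vector_mult_diff_distrib)
  also have "rls_adapt \<phi> ?y k ?\<Theta> - (\<chi> i. \<theta>) =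
      (\<chi> i. (1 - rls_L \<phi> k i * \<phi> k $ i) * ?x $ i) + (\<chi> i. rls_L \<phi> k i * \<epsilon> k \<omega> $ i)"
    by (simp add: vec_eq_iff rls_adapt_def observation_def rls_error_def algebra_simps)
  also have "A *v \<dots> = rls_transition A \<phi> k ?x + rls_noise A \<phi> k (\<epsilon> k \<omega>)"
    by (simp add: rls_transition_def rls_noise_def rls_decay_eq matrix_vector_right_distrib)
  finally show ?case
    by (simp add: Suc.IH)
qed

text \<open>With \<open>r\<close> and \<open>s\<close> the successive inverse gains, the square is
  \<open>(s - r) / (s * s)\<close>; replacing one \<open>s\<close> by the smaller \<open>r\<close>
  makes it a difference of gains.\<close>

lemma rls_L_power2_le: "(rls_L \<phi> k i)\<^sup>2 \<le> rls_P \<phi> k i - rls_P \<phi> (Suc k) i"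
proof -
  define r where "r = inverse (rls_P \<phi> k i)"
  define s where "s = inverse (rls_P \<phi> (Suc k) i)"
  have rs: "r > 0" "s = r + (\<phi> k $ i)\<^sup>2"
    unfolding r_def s_def by (rule inverse_rls_P_pos, rule inverse_rls_P_Suc)
  then have "s > 0" "r \<le> s"
    by (auto simp: add_pos_nonneg)
  have "rls_L \<phi> k i = \<phi> k $ i / s"
    by (simp add: rls_L_def s_def divide_inverse)
  then have "(rls_L \<phi> k i)\<^sup>2 = (s - r) / (s * s)"
    using rs by (simp add: power_divide flip: power2_eq_square)
  also have "\<dots> \<le> (s - r) / (r * s)"
    using rs(1) \<open>s > 0\<close> \<open>r \<le> s\<close> by (intro divide_left_mono mult_right_mono) auto
  also have "\<dots> = inverse r - inverse s"
    using rs(1) \<open>s > 0\<close> by (simp add: field_simps)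
  finally show ?thesis by (simp add: r_def s_def)
qed

text \<open>The differences of gains telescope, and the gains are decreasing and positive, hence
  convergent.\<close>

lemma summable_rls_L_power2: "summable (\<lambda>k. (rls_L \<phi> k i)\<^sup>2)"
proof -
  have "decseq (\<lambda>k. rls_P \<phi> k i)"
  proof (rule decseq_SucI)
    show "rls_P \<phi> (Suc k) i \<le> rls_P \<phi> k i" for k
      using rls_L_power2_le[of \<phi> k i] zero_le_power2[of "rls_L \<phi> k i"] by linarith
  qed
  then obtain l where "(\<lambda>k. rls_P \<phi> k i) \<longlonglongrightarrow> l"
    by (rule decseq_convergent[of _ 0]) (auto simp: rls_P_pos less_imp_le)
  then have "summable (\<lambda>k. rls_P \<phi> k i - rls_P \<phi> (Suc k) i)"
    by (rule telescope_summable')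
  then show ?thesis
    by (rule summable_comparison_test'[where N = 0]) (simp add: rls_L_power2_le)
qed

section \<open>Necessity of divergence\<close>

text \<open>The product of all decay factors at one time is at most each single factor, since all
  are at most 1. Averaging with row sums 1 preserves a lower bound common to all components, and the
  products telescope from inverse gains 1 at time 0.\<close>

lemma rls_transition_lower_bound:
  assumes A: "doubly_stochastic A"
  shows "inverse (\<Prod>i\<in>UNIV. inverse (rls_P \<phi> k i))
    \<le> driven (rls_transition A \<phi>) (\<lambda>_ _. 1) (\<chi> i. 1) (\<lambda>_. 0) k $ i"
proof (induction k arbitrary: i)
  case 0
  then show ?case by (simp add: rls_P_def)
next
  case (Suc k)
  define r where "r k i = inverse (rls_P \<phi> k i)" for k i
  have r: "r k i > 0" for k i
    unfolding r_def by (rule inverse_rls_P_pos)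
  have d: "0 < r k i / r (Suc k) i" "r k i / r (Suc k) i \<le> 1" for i
    unfolding r_def by (rule rls_decay_bounds)+
  let ?u = "driven (rls_transition A \<phi>) (\<lambda>_ _. 1) (\<chi> i. 1) (\<lambda>_. 0)"
  have IH: "inverse (\<Prod>i\<in>UNIV. r k i) \<le> ?u k $ i" for i
    unfolding r_def by (rule Suc.IH)
  have step: "inverse (\<Prod>i\<in>UNIV. r (Suc k) i) \<le> r k j / r (Suc k) j * ?u k $ j" for j
  proof -
    have "(\<Prod>i\<in>UNIV. r k i / r (Suc k) i) = r k j / r (Suc k) j * (\<Prod>i\<in>UNIV - {j}. r k i / r (Suc k) i)"
      by (rule prod.remove) auto
    also have "\<dots> \<le> r k j / r (Suc k) j"
      using d by (intro mult_right_le_one_le prod_le_1 prod_nonneg) (auto simp: less_imp_le)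
    finally have "(\<Prod>i\<in>UNIV. r k i / r (Suc k) i) * inverse (\<Prod>i\<in>UNIV. r k i) \<le> r k j / r (Suc k) j * ?u k $ j"
      using d(1)[of j] r by (intro mult_mono IH) (auto simp: prod_nonneg less_imp_le)
    moreover have "(\<Prod>i\<in>UNIV. r k i / r (Suc k) i) * inverse (\<Prod>i\<in>UNIV. r k i) = inverse (\<Prod>i\<in>UNIV. r (Suc k) i)"
      using r by (simp add: prod_dividef field_simps less_imp_neq[symmetric])
    ultimately show ?thesis by simp
  qed
  have "inverse (\<Prod>i\<in>UNIV. r (Suc k) i) = (\<Sum>j\<in>UNIV. A $ i $ j * inverse (\<Prod>i\<in>UNIV. r (Suc k) i))"
    using A by (simp add: doubly_stochastic_def flip: sum_distrib_right)
  also have "\<dots> \<le> (\<Sum>j\<in>UNIV. A $ i $ j * (r k j / r (Suc k) j * ?u k $ j))"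
    using A by (intro sum_mono mult_left_mono step) (auto simp: doubly_stochastic_def)
  also have "\<dots> = ?u (Suc k) $ i"
    by (simp add: rls_transition_def matrix_vector_mult_def r_def)
  finally show ?case
    by (simp add: r_def)
qed

lemma rls_transition_divergence:
  fixes A :: "real ^ 'n ^ 'n"
  assumes A: "doubly_stochastic A"
    and lim: "driven (rls_transition A \<phi>) (\<lambda>_ _. 1) (\<chi> i. 1) (\<lambda>_. 0) \<longlonglongrightarrow> 0"
  shows "filterlim (\<lambda>k. \<Sum>i\<in>UNIV. inverse (rls_P \<phi> k i)) at_top sequentially"
proof (rule ccontr)
  define R where "R k = (\<Sum>i\<in>UNIV. inverse (rls_P \<phi> k i))" for k
  have "incseq R"
    unfolding R_def incseq_def
    by (intro allI impI sum_mono) (rule incseqD[OF incseq_inverse_rls_P])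
  assume "\<not> filterlim (\<lambda>k. \<Sum>i\<in>UNIV. inverse (rls_P \<phi> k i)) at_top sequentially"
  \<comment> \<open>By monotonicity, a threshold that is not eventually passed bounds the sum at all
    times, and with it every inverse gain.\<close>
  then obtain Z where Z: "\<not> eventually (\<lambda>k. Z \<le> R k) sequentially"
    by (auto simp: filterlim_at_top R_def)
  have RZ: "R k \<le> Z" for k
  proof (rule ccontr)
    assume "\<not> R k \<le> Z"
    then have "Z \<le> R n" if "n \<ge> k" for n
      using incseqD[OF \<open>incseq R\<close> that] by linarith
    with Z show False
      by (auto simp: eventually_sequentially)
  qed
  have rZ: "inverse (rls_P \<phi> k i) \<le> Z" for k i
  proof -
    have "inverse (rls_P \<phi> k i) \<le> R k"
      unfolding R_def by (rule member_le_sum) (auto simp: rls_P_pos less_imp_le)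
    with RZ[of k] show ?thesis by linarith
  qed
  have "Z \<ge> 1"
    using rZ inverse_rls_P_ge_1 order.trans by blast
  have lower: "inverse (Z ^ CARD('n)) \<le> driven (rls_transition A \<phi>) (\<lambda>_ _. 1) (\<chi> i. 1) (\<lambda>_. 0) k $ i" for k i
  proof -
    have "(\<Prod>i\<in>UNIV. inverse (rls_P \<phi> k i)) \<le> (\<Prod>i\<in>(UNIV :: 'n set). Z)"
      using rZ by (intro prod_mono) (auto simp: rls_P_pos less_imp_le)
    then have "inverse (Z ^ CARD('n)) \<le> inverse (\<Prod>i\<in>UNIV. inverse (rls_P \<phi> k i))"
      by (intro le_imp_inverse_le prod_pos) (auto simp: rls_P_pos)
    then show ?thesis
      using rls_transition_lower_bound[OF A] by (rule order.trans)
  qed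
  have "inverse (Z ^ CARD('n)) \<le> 0 $ i" for i :: 'n
    by (rule LIMSEQ_le_const[OF tendsto_vec_nth[OF lim]]) (use lower in blast)
  moreover have "0 < inverse (Z ^ CARD('n))"
    using \<open>Z \<ge> 1\<close> by simp
  ultimately show False by simp
qed

section \<open>Equivalence of convergence and diverging inverse gains\<close>

theorem theorem2p1:
  fixes \<Omega> :: "'a measure"
    and A :: "real ^ 'n ^ 'n"
    and \<theta> M :: real
    and \<phi> :: "nat \<Rightarrow> real ^ 'n"
    and \<epsilon> :: "nat \<Rightarrow> 'a \<Rightarrow> real ^ 'n"
  assumes "prob_space \<Omega>"
    and "doubly_stochastic A" and "irreducible_mat A" and "aperiodic_mat A"
    and "irreducible_mat (transpose A ** A)"
    and "prob_space.indep_vars \<Omega> (\<lambda>_. borel) \<epsilon> UNIV"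
    and "\<And>i k. (\<integral>\<omega>. \<epsilon> k \<omega> $ i \<partial>\<Omega>) = 0"
    and "M > 0"
    and "\<And>i. (SUP k. \<integral>\<^sup>+ \<omega>. ennreal ((\<epsilon> k \<omega> $ i)\<^sup>2) \<partial>\<Omega>) < ennreal M"
  shows "(\<forall>\<Theta>\<^sub>0 :: real ^ 'n.
            (AE \<omega> in \<Omega>. (\<lambda>k. norm (rls_error A \<theta> \<phi> \<epsilon> \<Theta>\<^sub>0 k \<omega>)) \<longlonglongrightarrow> 0) \<and>
            (\<lambda>k. \<integral>\<^sup>+ \<omega>. ennreal ((norm (rls_error A \<theta> \<phi> \<epsilon> \<Theta>\<^sub>0 k \<omega>))\<^sup>2) \<partial>\<Omega>) \<longlonglongrightarrow> 0)
         \<longleftrightarrow> filterlim (\<lambda>k. \<Sum>i\<in>UNIV. inverse (rls_P \<phi> (k + 1) i)) at_top sequentially"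
    (is "?conv \<longleftrightarrow> ?div")
proof
  interpret prob_space \<Omega> by fact
  note A = assms(2)
  let ?T = "rls_transition A \<phi>" and ?w = "\<lambda>k \<omega>. rls_noise A \<phi> k (\<epsilon> k \<omega>)"
  \<comment> \<open>The statement sums the inverse gains at time \<open>k + 1\<close>, the lemmas at
    time \<open>k\<close>.\<close>
  have div_shift: "?div \<longleftrightarrow> filterlim (\<lambda>k. \<Sum>i\<in>UNIV. inverse (rls_P \<phi> k i)) at_top sequentially"
    using filterlim_sequentially_Suc[of "\<lambda>k. \<Sum>i\<in>UNIV. inverse (rls_P \<phi> k i)" at_top] by simp
  show ?div if ?conv
  proof -
    let ?x = "\<lambda>z \<omega>. driven ?T (\<lambda>_ _. 1) z (\<lambda>j. ?w j \<omega>)"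
    \<comment> \<open>The initial estimate \<open>z + (\<chi> i. \<theta>)\<close> makes the initial
      error exactly \<open>z\<close>.\<close>
    have conv: "AE \<omega> in \<Omega>. ?x z \<omega> \<longlonglongrightarrow> 0" for z
      using that[rule_format, of "z + (\<chi> i. \<theta>)"]
      by (simp add: rls_error_eq_driven[OF A] tendsto_norm_zero_iff)
    \<comment> \<open>The trajectories from 1 and 0 along the same noise path differ by a
      deterministic sequence, for which almost sure convergence in a probability space is plain
      convergence.\<close>
    have "AE \<omega> in \<Omega>. driven ?T (\<lambda>_ _. 1) (\<chi> i. 1) (\<lambda>_. 0) \<longlonglongrightarrow> 0"
      using conv[of "\<chi> i. 1"] conv[of 0]
    proof eventually_elim
      case (elim \<omega>)
      have "?x (\<chi> i. 1) \<omega> k = driven ?T (\<lambda>_ _. 1) (\<chi> i. 1) (\<lambda>_. 0) k + ?x 0 \<omega> k" for k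
        using driven_add[of ?T "\<chi> i. 1" 0 "\<lambda>_. 0" "\<lambda>j. ?w j \<omega>" k]
        by (simp add: linear_rls_transition)
      then show ?case
        using tendsto_diff[OF elim] by simp
    qed
    then show ?div
      unfolding div_shift by (intro rls_transition_divergence[OF A]) simp
  qed
  show ?conv if ?div
  proof -
    have \<epsilon>_meas [measurable]: "\<epsilon> k \<in> borel_measurable \<Omega>" for k
      using assms(6) by (auto simp: indep_vars_def)
    have [measurable]: "(\<lambda>\<omega>. \<epsilon> k \<omega> $ i) \<in> borel_measurable \<Omega>" for k i
      using \<epsilon>_meas
      by (rule measurable_compose)
        (intro borel_measurable_continuous_onI linear_continuous_on bounded_linear_vec_nth)
    have le_M: "(\<integral>\<^sup>+ \<omega>. ennreal ((\<epsilon> k \<omega> $ i)\<^sup>2) \<partial>\<Omega>) \<le> ennreal M" for k i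
      using assms(9)[of i] by (intro order.trans[OF SUP_upper less_imp_le]) auto
    have comp_sq: "integrable \<Omega> (\<lambda>\<omega>. (\<epsilon> k \<omega> $ i)\<^sup>2)" for k i
    proof (rule integrableI_nonneg)
      show "(\<integral>\<^sup>+ \<omega>. ennreal ((\<epsilon> k \<omega> $ i)\<^sup>2) \<partial>\<Omega>) < \<infinity>"
        using le_M[of k i] by (simp add: le_less_trans ennreal_less_top)
    qed auto
    have comp_le: "expectation (\<lambda>\<omega>. (\<epsilon> k \<omega> $ i)\<^sup>2) \<le> M" for k i
      using le_M[of k i] \<open>M > 0\<close> nn_integral_eq_integral[OF comp_sq[of k i]] by simp
    \<comment> \<open>Integrability lets the mean be evaluated componentwise; a Bochner integral
      that does not exist would default to 0.\<close>
    have \<epsilon>_int: "integrable \<Omega> (\<epsilon> k)" for k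
      by (rule integrable_if_norm_power2_integrable) (auto simp: norm_vec_power2 comp_sq)
    have \<epsilon>_mean: "expectation (\<epsilon> k) = 0" for k
      using integral_bounded_linear[OF bounded_linear_vec_nth \<epsilon>_int[of k]] assms(7)
      by (simp add: vec_eq_iff)
    have w_lin: "bounded_linear (rls_noise A \<phi> k)" for k
      using linear_rls_noise by (rule linear_linear[THEN iffD2])
    have w_meas: "rls_noise A \<phi> k \<in> borel_measurable borel" for k
      by (intro borel_measurable_continuous_onI linear_continuous_on w_lin)
    have w_indep: "indep_vars (\<lambda>_. borel) ?w UNIV"
      using indep_vars_compose2[OF assms(6), of "rls_noise A \<phi>" "\<lambda>_. borel"] w_meas by simp
    have w_mean: "expectation (?w k) = 0" for k
      using integral_bounded_linear[OF w_lin \<epsilon>_int[of k]]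
      by (simp add: \<epsilon>_mean linear_0[OF linear_rls_noise])
    \<comment> \<open>\<open>A\<close> does not increase the norm, so the noise energy is weighted
      by the summable squares of \<open>rls_L\<close>.\<close>
    have w_le: "(norm (?w k \<omega>))\<^sup>2 \<le> (\<Sum>i\<in>UNIV. (rls_L \<phi> k i)\<^sup>2 * (\<epsilon> k \<omega> $ i)\<^sup>2)" for k \<omega>
    proof -
      have "(norm (?w k \<omega>))\<^sup>2 \<le> (norm (\<chi> i. rls_L \<phi> k i * \<epsilon> k \<omega> $ i))\<^sup>2"
        unfolding rls_noise_def by (intro power_mono doubly_stochastic_norm_le A) simp
      then show ?thesis
        by (simp add: norm_vec_power2 power_mult_distrib)
    qed
    have dom: "integrable \<Omega> (\<lambda>\<omega>. \<Sum>i\<in>UNIV. (rls_L \<phi> k i)\<^sup>2 * (\<epsilon> k \<omega> $ i)\<^sup>2)" for k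
      using comp_sq by simp
    have w_sq: "integrable \<Omega> (\<lambda>\<omega>. (norm (?w k \<omega>))\<^sup>2)" for k
    proof (rule Bochner_Integration.integrable_bound[OF dom])
      have "(\<lambda>\<omega>. ?w k \<omega>) \<in> borel_measurable \<Omega>"
        using \<epsilon>_meas w_meas by (rule measurable_compose)
      then show "(\<lambda>\<omega>. (norm (?w k \<omega>))\<^sup>2) \<in> borel_measurable \<Omega>"
        by measurable
    qed (use w_le in \<open>auto intro!: AE_I2 intro: order.trans[OF _ abs_ge_self]\<close>)
    have w_moment: "expectation (\<lambda>\<omega>. (norm (?w k \<omega>))\<^sup>2) \<le> (\<Sum>i\<in>UNIV. M * (rls_L \<phi> k i)\<^sup>2)" for k
    proof -
      have "expectation (\<lambda>\<omega>. (norm (?w k \<omega>))\<^sup>2) \<le> expectation (\<lambda>\<omega>. \<Sum>i\<in>UNIV. (rls_L \<phi> k i)\<^sup>2 * (\<epsilon> k \<omega> $ i)\<^sup>2)"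
        by (rule integral_mono[OF w_sq dom w_le])
      also have "\<dots> = (\<Sum>i\<in>UNIV. (rls_L \<phi> k i)\<^sup>2 * expectation (\<lambda>\<omega>. (\<epsilon> k \<omega> $ i)\<^sup>2))"
        using comp_sq by simp
      also have "\<dots> \<le> (\<Sum>i\<in>UNIV. M * (rls_L \<phi> k i)\<^sup>2)"
        by (subst mult.commute, intro sum_mono mult_right_mono comp_le) simp
      finally show ?thesis .
    qed
    have w_summ: "summable (\<lambda>k. expectation (\<lambda>\<omega>. (norm (?w k \<omega>))\<^sup>2))"
    proof (rule summable_comparison_test'[where N = 0])
      show "summable (\<lambda>k. \<Sum>i\<in>UNIV. M * (rls_L \<phi> k i)\<^sup>2)"
        by (intro summable_sum summable_mult summable_rls_L_power2)
    qed (simp add: w_moment)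
    have stable: "x \<longlonglongrightarrow> 0" if "\<And>k. k \<ge> N \<Longrightarrow> x (Suc k) = ?T k (x k)" for x N
      using that \<open>?div\<close> unfolding div_shift rls_transition_def
      by (intro homogeneous_rls_tendsto_0[OF A assms(5), where r = "\<lambda>k i. inverse (rls_P \<phi> k i)"]
          inverse_rls_P_pos incseq_inverse_rls_P)
    note lim = driven_tendsto_0[OF w_indep w_mean w_sq w_summ
        linear_rls_transition norm_rls_transition_le[OF A] stable]
    show ?conv
      unfolding rls_error_eq_driven[OF A] tendsto_norm_zero_iff by (intro allI conjI lim)
  qed
qed

end
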